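(* Let $0<\alpha<1/3$ and define $\Phi:\mathbb{R}\to\mathbb{R}$ by $$\Phi(w)=\begin{cases}\frac{1}{\sqrt{2\pi}} & 0\le |w|<(1-\alpha)\pi,\\ \frac{1}{\sqrt{2\pi}}\cos\left(\frac{1}{4\alpha}\big(|w|-(1-\alpha)\pi\big)\right) & (1-\alpha)\pi\le |w|<(1+\alpha)\pi,\\ 0 & |w|\ge (1+\alpha)\pi.\end{cases}$$ Let $H$ be defined by $H\left(\frac{w}{2}\right)=2\sqrt{\pi}\,\Phi(w)$ for all $w\in\mathbb{R}$, and let $$\Psi^{(deO)}(w)=e^{-jw/2}\frac{1}{\sqrt{2}}H^{*}\left(\frac{w}{2}-\pi\right)\Phi\left(\frac{w}{2}\right),\qquad w\in\mathbb{R}.$$ Then $\Psi^{(deO)}(w)=e^{-jw/2}S^{(deO)}(w)$ for all $w\in\mathbb{R}$, where $$S^{(deO)}(w)=\begin{cases}0 & w<\pi(1-\alpha),\\ \frac{1}{\sqrt{2\pi}}\cos\left(\frac{1}{4\alpha}\big(w-\pi(1+\alpha)\big)\right) & \pi(1-\alpha)\le w<\pi(1+\alpha),\\ \frac{1}{\sqrt{2\pi}} & \pi(1+\alpha)\le w<2\pi(1-\alpha),\\ \frac{1}{\sqrt{2\pi}}\cos\left(\frac{1}{8\alpha}\big(w-2\pi(1-\alpha)\big)\right) & 2\pi(1-\alpha)\le w<2\pi(1+\alpha),\\ 0 & w\ge 2\pi(1+\alpha).\end{cases}$$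
   Context: $j$ is the imaginary unit and $^{*}$ denotes complex conjugation. $\Phi$ is the square root of the raised cosine spectrum with roll-off $\alpha$, and $\Psi^{(deO)}$ is the Fourier spectrum of the complex "de Oliveira" wavelet. As in the paper, $H$ is given by the displayed formula on the whole line (no periodization). *)

theory Defs
  imports Complex_Main
begin

definition Phi :: "real \<Rightarrow> real \<Rightarrow> real" where
  "Phi \<alpha> w =
     (if \<bar>w\<bar> < (1 - \<alpha>) * pi then 1 / sqrt (2 * pi)
      else if \<bar>w\<bar> < (1 + \<alpha>) * pi
        then 1 / sqrt (2 * pi) * cos (1 / (4 * \<alpha>) * (\<bar>w\<bar> - (1 - \<alpha>) * pi))
      else 0)"

definition Psi_deO :: "(real \<Rightarrow> complex) \<Rightarrow> real \<Rightarrow> real \<Rightarrow> complex" where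
  "Psi_deO H \<alpha> w =
     exp (- \<i> * complex_of_real w / 2) * complex_of_real (1 / sqrt 2)
       * cnj (H (w / 2 - pi)) * complex_of_real (Phi \<alpha> (w / 2))"

definition S_deO :: "real \<Rightarrow> real \<Rightarrow> real" where
  "S_deO \<alpha> w =
     (if w < pi * (1 - \<alpha>) then 0
      else if w < pi * (1 + \<alpha>)
        then 1 / sqrt (2 * pi) * cos (1 / (4 * \<alpha>) * (w - pi * (1 + \<alpha>)))
      else if w < 2 * pi * (1 - \<alpha>) then 1 / sqrt (2 * pi)
      else if w < 2 * pi * (1 + \<alpha>)
        then 1 / sqrt (2 * pi) * cos (1 / (8 * \<alpha>) * (w - 2 * pi * (1 - \<alpha>)))
      else 0)"

end

theory Submission
  imports Defs
begin

text \<open>Since \<open>H (w / 2 - \<pi>) = 2 \<surd>\<pi> \<Phi> (w - 2 \<pi>)\<close>, everything reduces to the product of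
  \<open>\<Phi> (w - 2 \<pi>)\<close> and \<open>\<Phi> (w / 2)\<close>. As \<open>\<alpha> < 1/3\<close>, the transition band of either factor lies where
  the other one is constant, so the two cosines never meet.\<close>

lemma Phi_flat: "\<bar>w\<bar> < (1 - \<alpha>) * pi \<Longrightarrow> Phi \<alpha> w = 1 / sqrt (2 * pi)"
  by (simp add: Phi_def)

lemma Phi_zero:
  assumes "0 < \<alpha>" and "(1 + \<alpha>) * pi \<le> \<bar>w\<bar>"
  shows "Phi \<alpha> w = 0"
proof -
  have "(1 - \<alpha>) * pi \<le> (1 + \<alpha>) * pi"
    using assms(1) by (intro mult_right_mono) auto
  then have "\<not> \<bar>w\<bar> < (1 - \<alpha>) * pi" "\<not> \<bar>w\<bar> < (1 + \<alpha>) * pi"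
    using assms(2) by linarith+
  then show ?thesis
    by (simp only: Phi_def if_False)
qed

lemma Phi_cos:
  assumes "(1 - \<alpha>) * pi \<le> \<bar>w\<bar>" and "\<bar>w\<bar> < (1 + \<alpha>) * pi"
  shows "Phi \<alpha> w = 1 / sqrt (2 * pi) * cos (1 / (4 * \<alpha>) * (\<bar>w\<bar> - (1 - \<alpha>) * pi))"
  using assms by (simp add: Phi_def)

text \<open>The factor \<open>sqrt (2 * pi)\<close> is the product of the constants
  \<open>1 / sqrt 2\<close> and \<open>2 * sqrt pi\<close>. It cancels the amplitude of one
  \<open>Phi\<close>, so a single \<open>1 / sqrt (2 * pi)\<close> survives in
  \<open>S_deO\<close>.\<close>

lemma Phi_shift_mult_Phi_half:
  assumes "0 < \<alpha>" and "\<alpha> < 1 / 3"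
  shows "sqrt (2 * pi) * Phi \<alpha> (w - 2 * pi) * Phi \<alpha> (w / 2) = S_deO \<alpha> w"
proof -
  \<comment> \<open>With \<open>a\<close> for \<alpha> * pi all breakpoints become linear in
    \<open>a\<close> and \<open>pi\<close>, and \<alpha> < 1/3 becomes \<open>3 * a < pi\<close>,
    that is, \<open>pi + a < 2 * pi - 2 * a\<close>: the first transition band ends before the
    second begins.\<close>
  define a where "a = \<alpha> * pi"
  have a: "0 < a" "3 * a < pi"
    using assms by (simp_all add: a_def)
  have e: "(1 - \<alpha>) * pi = pi - a" "(1 + \<alpha>) * pi = pi + a"
    "pi * (1 - \<alpha>) = pi - a" "pi * (1 + \<alpha>) = pi + a"
    "2 * pi * (1 - \<alpha>) = 2 * pi - 2 * a" "2 * pi * (1 + \<alpha>) = 2 * pi + 2 * a"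
    by (simp_all add: a_def algebra_simps)
  note flat = Phi_flat[of _ \<alpha>, unfolded e]
  note zero = Phi_zero[OF assms(1), unfolded e]
  note cosine = Phi_cos[of \<alpha>, unfolded e]
  note S = S_deO_def[of \<alpha> w, unfolded e]
  \<comment> \<open>The points \<open>pi - a\<close> and \<open>pi + a\<close> stand alone: there
    \<open>w - 2 * pi\<close> is negative, so taking its absolute value reverses the order and the
    half-open bands of \<open>Phi\<close> and \<open>S_deO\<close> include opposite
    endpoints.\<close>
  consider "w < pi - a" | "w = pi - a" | "pi - a < w" "w < pi + a" | "w = pi + a"
    | "pi + a < w" "w < 2 * pi - 2 * a"
    | "2 * pi - 2 * a \<le> w" "w < 2 * pi + 2 * a" | "2 * pi + 2 * a \<le> w"
    by linarith
  then show ?thesis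
  proof cases
    case 1
    then have "Phi \<alpha> (w - 2 * pi) = 0"
      using a by (intro zero) linarith
    then show ?thesis
      using 1 by (simp add: S)
  next
    case 2
    then have "Phi \<alpha> (w - 2 * pi) = 0"
      using a by (intro zero) linarith
    \<comment> \<open>\<open>S_deO\<close> is already in its cosine branch here, but
      \<open>w - (pi + a) = - 2 * a\<close> places the argument at a zero of the cosine.\<close>
    moreover have "1 / (4 * \<alpha>) * (w - (pi + a)) = - (pi / 2)"
      using 2 assms by (simp add: a_def field_simps)
    moreover have "\<not> w < pi - a" "w < pi + a"
      using 2 a by linarith+
    ultimately have "Phi \<alpha> (w - 2 * pi) = 0" "S_deO \<alpha> w = 0"
      by (simp_all only: S if_True if_False cos_minus cos_pi_half mult_zero_right)
    then show ?thesis
      by simp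
  next
    case 3
    have abs: "\<bar>w - 2 * pi\<bar> = 2 * pi - w"
      using 3 a by linarith
    have "Phi \<alpha> (w - 2 * pi)
        = 1 / sqrt (2 * pi) * cos (1 / (4 * \<alpha>) * (2 * pi - w - (pi - a)))"
      using 3 a by (subst cosine) (linarith, linarith, simp only: abs)
    \<comment> \<open>The reflection only changes the sign of the argument, which the even cosine
      absorbs.\<close>
    also have "1 / (4 * \<alpha>) * (2 * pi - w - (pi - a)) = - (1 / (4 * \<alpha>) * (w - (pi + a)))"
      using assms(1) by (simp add: field_simps)
    finally have "Phi \<alpha> (w - 2 * pi)
        = 1 / sqrt (2 * pi) * cos (1 / (4 * \<alpha>) * (w - (pi + a)))"
      by (simp only: cos_minus)
    \<comment> \<open>Here \<open>w / 2 < (pi + a) / 2 < pi - a\<close>, the last step being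
      \<open>3 * a < pi\<close>.\<close>
    moreover have "Phi \<alpha> (w / 2) = 1 / sqrt (2 * pi)"
      using 3 a by (intro flat) linarith
    ultimately show ?thesis
      using 3 by (simp add: S)
  next
    case 4
    have abs: "\<bar>w - 2 * pi\<bar> = pi - a"
      using 4 a by linarith
    \<comment> \<open>\<open>Phi\<close> is in its cosine branch, with argument 0, so it takes the
      flat value.\<close>
    have "Phi \<alpha> (w - 2 * pi) = 1 / sqrt (2 * pi)"
      using a by (subst cosine) (simp_all add: abs)
    moreover have "Phi \<alpha> (w / 2) = 1 / sqrt (2 * pi)"
      using 4 a by (intro flat) linarith
    moreover have "S_deO \<alpha> w = 1 / sqrt (2 * pi)"
      unfolding S using 4 a by simp
    ultimately show ?thesis
      by simp
  next
    case 5
    then have "Phi \<alpha> (w - 2 * pi) = 1 / sqrt (2 * pi)" "Phi \<alpha> (w / 2) = 1 / sqrt (2 * pi)"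
      using a by (intro flat, linarith)+
    then show ?thesis
      using 5 a by (simp add: S)
  next
    case 6
    have abs: "\<bar>w / 2\<bar> = w / 2"
      using 6 a by linarith
    have "Phi \<alpha> (w / 2) = 1 / sqrt (2 * pi) * cos (1 / (4 * \<alpha>) * (w / 2 - (pi - a)))"
      using 6 a by (subst cosine) (linarith, linarith, simp only: abs)
    also have "1 / (4 * \<alpha>) * (w / 2 - (pi - a)) = 1 / (8 * \<alpha>) * (w - (2 * pi - 2 * a))"
      using assms by (simp add: field_simps)
    finally have "Phi \<alpha> (w / 2)
        = 1 / sqrt (2 * pi) * cos (1 / (8 * \<alpha>) * (w - (2 * pi - 2 * a)))" .
    \<comment> \<open>The distance from \<open>w\<close> to \<open>2 * pi\<close> is at most
      \<open>2 * a\<close>, which is below \<open>pi - a\<close> again by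
      \<open>3 * a < pi\<close>.\<close>
    moreover have "Phi \<alpha> (w - 2 * pi) = 1 / sqrt (2 * pi)"
      using 6 a by (intro flat) linarith
    ultimately show ?thesis
      using 6 a by (simp add: S)
  next
    case 7
    then have "Phi \<alpha> (w / 2) = 0"
      using a by (intro zero) linarith
    then show ?thesis
      using 7 a by (simp add: S)
  qed
qed

theorem mainTheorem4:
  fixes \<alpha> :: real and H :: "real \<Rightarrow> complex"
  assumes "0 < \<alpha>" and "\<alpha> < 1 / 3"
    and "\<forall>w::real. H (w / 2) = complex_of_real (2 * sqrt pi * Phi \<alpha> w)"
  shows "\<forall>w::real. Psi_deO H \<alpha> w
           = exp (- \<i> * complex_of_real w / 2) * complex_of_real (S_deO \<alpha> w)"
proof
  fix w :: real
  have H: "H (w / 2 - pi) = complex_of_real (2 * sqrt pi * Phi \<alpha> (w - 2 * pi))"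
    using assms(3)[rule_format, of "w - 2 * pi"] by (simp add: diff_divide_distrib)
  have "1 / sqrt 2 * (2 * sqrt pi) = sqrt (2 * pi)"
    by (simp add: real_sqrt_mult field_simps)
  then have S: "S_deO \<alpha> w
      = 1 / sqrt 2 * (2 * sqrt pi * Phi \<alpha> (w - 2 * pi)) * Phi \<alpha> (w / 2)"
    using Phi_shift_mult_Phi_half[OF assms(1,2), of w] by (simp only: mult.assoc[symmetric])
  show "Psi_deO H \<alpha> w
      = exp (- \<i> * complex_of_real w / 2) * complex_of_real (S_deO \<alpha> w)"
    by (simp only: Psi_deO_def H S complex_cnj_complex_of_real) (simp only: of_real_mult mult.assoc)
qed

end
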